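(* Let $n$ be a positive integer, let $D$ be the incidence matrix of a finite projective plane of order $n$, let $m=n^2+n+1$, and let $\vec{s}=(\tfrac1m,\tfrac1m,\dots,\tfrac1m)^T\in\mathbb{R}^m$. Then $(D,\vec{s})$ is an ATAC data distribution on $m$ machines with minimal data storage limit, i.e. $L(D,\vec{s})=L_{\min}(m)$.
   Context: A data distribution on $m$ machines is a pair $(D,\vec{s})$, where, for some positive integer $x$ (the number of data groups, not fixed in advance), $D=(d_{ij})$ is an $m\times x$ matrix with entries in $\{0,1\}$ ($d_{ij}=1$ iff data group $j$ is stored on machine $i$), and $\vec{s}\in\mathbb{R}^x$ is a column vector with non-negative entries summing to $1$ ($s_j$ is the fraction of all data lying in data group $j$). It is an ATAC (All-to-All Comparison) data distribution if every entry of $D^TD$ is nonzero, i.e. for every pair of data groups (including a group paired with itself) some machine holds both. The data storage limit of $(D,\vec{s})$ is $L(D,\vec{s})=\max_{1\le i\le m}(D\vec{s})_i$. The minimal data storage limit $L_{\min}(m)$ is the minimum of $L(D,\vec{s})$ over all ATAC data distributions on $m$ machines (over all $x$). A finite projective plane of order $n$ is a set of $n^2+n+1$ points and $n^2+n+1$ lines with an incidence relation such that: every pair of distinct points has exactly one line passing through both; every pair of distinct lines intersects in exactly one point; every line contains $n+1$ points; every point is on $n+1$ lines. (The triangle, $n=1$, is allowed.) Its incidence matrix has rows indexed by lines and columns indexed by points, with entry $1$ if the line contains the point and $0$ otherwise. *)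

theory Defs
  imports "Jordan_Normal_Form.Matrix"
begin

text \<open>
  Rows of \<open>D\<close> are machines, columns are data groups, both indexed from 0.  The number \<open>x\<close> of data
  groups is existentially quantified, so \<open>min_storage_limit\<close> below ranges over all \<open>x\<close>.
\<close>

definition data_distribution :: "nat \<Rightarrow> real mat \<Rightarrow> real vec \<Rightarrow> bool" where
  "data_distribution m D s \<longleftrightarrow>
     (\<exists>x>0. D \<in> carrier_mat m x \<and> s \<in> carrier_vec x \<and>
        (\<forall>i<m. \<forall>j<x. D $$ (i, j) \<in> {0, 1}) \<and>
        (\<forall>j<x. s $ j \<ge> 0) \<and> (\<Sum>j<x. s $ j) = 1)"

definition ATAC_distribution :: "nat \<Rightarrow> real mat \<Rightarrow> real vec \<Rightarrow> bool" where
  "ATAC_distribution m D s \<longleftrightarrow>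
     data_distribution m D s \<and>
     (\<forall>j<dim_col D. \<forall>k<dim_col D. (transpose_mat D * D) $$ (j, k) \<noteq> 0)"

definition storage_limit :: "real mat \<Rightarrow> real vec \<Rightarrow> real" where
  "storage_limit D s = Max {(D *\<^sub>v s) $ i | i. i < dim_row D}"

definition min_storage_limit :: "nat \<Rightarrow> real" where
  "min_storage_limit m = (LEAST r. r \<in> {storage_limit D s | D s. ATAC_distribution m D s})"

definition projective_plane ::
  "nat \<Rightarrow> 'p set \<Rightarrow> 'l set \<Rightarrow> ('p \<Rightarrow> 'l \<Rightarrow> bool) \<Rightarrow> bool" where
  "projective_plane n P L inc \<longleftrightarrow>
     finite P \<and> card P = n^2 + n + 1 \<and>
     finite L \<and> card L = n^2 + n + 1 \<and>
     (\<forall>p\<in>P. \<forall>q\<in>P. p \<noteq> q \<longrightarrow> (\<exists>!l. l \<in> L \<and> inc p l \<and> inc q l)) \<and>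
     (\<forall>k\<in>L. \<forall>l\<in>L. k \<noteq> l \<longrightarrow> (\<exists>!p. p \<in> P \<and> inc p k \<and> inc p l)) \<and>
     (\<forall>l\<in>L. card {p \<in> P. inc p l} = n + 1) \<and>
     (\<forall>p\<in>P. card {l \<in> L. inc p l} = n + 1)"

text \<open>
  The incidence matrix is determined only up to the order in which lines and points are listed;
  any enumeration is allowed.
\<close>

definition is_incidence_matrix ::
  "'p set \<Rightarrow> 'l set \<Rightarrow> ('p \<Rightarrow> 'l \<Rightarrow> bool) \<Rightarrow> real mat \<Rightarrow> bool" where
  "is_incidence_matrix P L inc D \<longleftrightarrow>
     (\<exists>line point. bij_betw line {..<card L} L \<and> bij_betw point {..<card P} P \<and>
        D = mat (card L) (card P) (\<lambda>(i, j). if inc (point j) (line i) then 1 else 0))"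

end

theory Submission
  imports Defs
begin

text \<open>
  Suppose \<open>n * (n + 1) \<le> m\<close>, and let \<open>c j\<close> be the number of machines holding data group \<open>j\<close>.
  If every \<open>c j\<close> is at least \<open>n + 1\<close>, then the loads of all \<open>m\<close> machines add up to at least
  \<open>n + 1\<close>, so some load is at least \<open>(n + 1) / m\<close>.  Otherwise \<open>c k \<le> n\<close> for some \<open>k\<close>.  The machines
  holding \<open>k\<close> jointly hold every data group, so their at most \<open>n\<close> loads add up to at least 1, and
  one of them is at least \<open>1 / n \<ge> (n + 1) / m\<close>.  In a projective plane every load equals
  \<open>(n + 1) / m\<close>.
\<close>

lemma load_le_storage_limit:
  assumes "i < dim_row D"
  shows "(D *\<^sub>v s) $ i \<le> storage_limit D s"
  unfolding storage_limit_def using assms by (intro Max_ge) (auto simp del: index_mult_mat_vec)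

lemma storage_limit_constant:
  assumes "dim_row D > 0" and "\<And>i. i < dim_row D \<Longrightarrow> (D *\<^sub>v s) $ i = c"
  shows "storage_limit D s = c"
proof -
  have "{(D *\<^sub>v s) $ i | i. i < dim_row D} = {c}"
    using assms by (auto intro: exI[of _ 0])
  then show ?thesis
    by (simp add: storage_limit_def)
qed

lemma load_eq_sum:
  assumes "D \<in> carrier_mat m x" "s \<in> carrier_vec x" "i < m"
  shows "(D *\<^sub>v s) $ i = (\<Sum>j<x. D $$ (i, j) * s $ j)"
  using assms by (auto simp: scalar_prod_def lessThan_atLeast0 intro!: sum.cong)

text \<open>For a 0/1 matrix this sum counts the machines holding both \<open>j\<close> and
  \<open>k\<close>, so the ATAC condition says that the count is never 0.\<close>

lemma gram_entry_eq_sum: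
  assumes "D \<in> carrier_mat m x" "j < x" "k < x"
  shows "(transpose_mat D * D) $$ (j, k) = (\<Sum>i<m. D $$ (i, j) * D $$ (i, k))"
  using assms by (auto simp: scalar_prod_def lessThan_atLeast0 intro!: sum.cong)

lemma sum_zero_one_eq_card:
  fixes f :: "'a \<Rightarrow> real"
  assumes "finite A" "\<And>i. i \<in> A \<Longrightarrow> f i \<in> {0, 1}"
  shows "sum f A = real (card {i \<in> A. f i = 1})"
proof -
  have "sum f A = (\<Sum>i\<in>A. if f i = 1 then 1 else 0)"
    using assms(2) by (intro sum.cong) auto
  also have "\<dots> = real (card {i \<in> A. f i = 1})"
    using assms(1) by (simp add: sum.If_cases Collect_conj_eq)
  finally show ?thesis .
qed

lemma ATAC_storage_limit_ge:
  assumes ATAC: "ATAC_distribution m D s" and m: "n * (n + 1) \<le> m"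
  shows "storage_limit D s \<ge> (real n + 1) / real m"
proof -
  let ?M = "storage_limit D s"
  from ATAC obtain x where x: "x > 0" and D: "D \<in> carrier_mat m x" and s: "s \<in> carrier_vec x"
    and D01: "\<And>i j. i < m \<Longrightarrow> j < x \<Longrightarrow> D $$ (i, j) \<in> {0, 1}"
    and s0: "\<And>j. j < x \<Longrightarrow> s $ j \<ge> 0" and s1: "(\<Sum>j<x. s $ j) = 1"
    unfolding ATAC_distribution_def data_distribution_def by blast
  define c where "c j = (\<Sum>i<m. D $$ (i, j))" for j
  define l where "l i = (\<Sum>j<x. D $$ (i, j) * s $ j)" for i
  have D0: "D $$ (i, j) \<ge> 0" if "i < m" "j < x" for i j
    using D01[OF that] by auto
  have meet: "\<exists>i<m. D $$ (i, j) = 1 \<and> D $$ (i, k) = 1" if "j < x" "k < x" for j k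
  proof -
    have "(\<Sum>i<m. D $$ (i, j) * D $$ (i, k)) \<noteq> 0"
      using ATAC gram_entry_eq_sum[OF D that] D that by (auto simp: ATAC_distribution_def)
    then obtain i where "i < m" "D $$ (i, j) * D $$ (i, k) \<noteq> 0"
      by (metis (no_types, lifting) lessThan_iff sum.neutral)
    with D01[OF \<open>i < m\<close> that(1)] D01[OF \<open>i < m\<close> that(2)] show ?thesis
      by (intro exI[of _ i]) auto
  qed
  \<comment> \<open>Group 0 paired with itself lies on some machine, so there is at least one
    machine.\<close>
  have m0: "m > 0"
    using meet[OF x x] by auto
  have lM: "l i \<le> ?M" if "i < m" for i
    using load_le_storage_limit[of i D s] load_eq_sum[OF D s that] D that by (auto simp: l_def)
  have l0: "l i \<ge> 0" if "i < m" for i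
    unfolding l_def using D0 s0 that by (intro sum_nonneg) auto
  have M0: "?M \<ge> 0"
    using l0[OF m0] lM[OF m0] by simp
  \<comment> \<open>The bound is proved without quotients, so the case \<open>n = 0\<close> never
    leads to a division by 0.\<close>
  have "real n + 1 \<le> real m * ?M"
  proof (cases "\<forall>j<x. real n + 1 \<le> c j")
    case True
    have "real n + 1 = (\<Sum>j<x. (real n + 1) * s $ j)"
      using s1 by (simp flip: sum_distrib_left)
    also have "\<dots> \<le> (\<Sum>j<x. c j * s $ j)"
      using True s0 by (intro sum_mono mult_right_mono) auto
    \<comment> \<open>Double counting: group \<open>j\<close> adds \<open>s $ j\<close> to the load
      of each of the \<open>c j\<close> machines holding it.\<close>
    also have "\<dots> = (\<Sum>i<m. l i)"
      unfolding c_def l_def by (simp add: sum_distrib_right) (rule sum.swap)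
    also have "\<dots> \<le> real m * ?M"
      using sum_bounded_above[of "{..<m}" l ?M] lM by simp
    finally show ?thesis .
  next
    case False
    then obtain k where k: "k < x" "c k < real n + 1"
      by auto
    \<comment> \<open>Being a cardinality, \<open>c k\<close> is an integer, which sharpens
      \<open>c k < n + 1\<close> to \<open>c k \<le> n\<close>.\<close>
    have "c k = real (card {i \<in> {..<m}. D $$ (i, k) = 1})"
      unfolding c_def using D01 k by (intro sum_zero_one_eq_card) auto
    with k have ck: "c k \<le> real n"
      by simp
    have "1 = (\<Sum>j<x. s $ j)"
      using s1 by simp
    \<comment> \<open>The inner sum counts the machines holding both \<open>k\<close> and
      \<open>j\<close>, hence is at least 1.\<close>
    also have "\<dots> \<le> (\<Sum>j<x. (\<Sum>i<m. D $$ (i, k) * D $$ (i, j)) * s $ j)"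
    proof (intro sum_mono)
      fix j assume "j \<in> {..<x}"
      then have j: "j < x" by simp
      obtain i where i: "i < m" "D $$ (i, k) = 1" "D $$ (i, j) = 1"
        using meet[OF k(1) j] by blast
      have "D $$ (i, k) * D $$ (i, j) \<le> (\<Sum>i<m. D $$ (i, k) * D $$ (i, j))"
        using i(1) D0 j k(1) by (intro member_le_sum) auto
      then have "1 \<le> (\<Sum>i<m. D $$ (i, k) * D $$ (i, j))"
        using i by simp
      from mult_right_mono[OF this s0[OF j]]
      show "s $ j \<le> (\<Sum>i<m. D $$ (i, k) * D $$ (i, j)) * s $ j"
        by simp
    qed
    also have "\<dots> = (\<Sum>j<x. \<Sum>i<m. D $$ (i, k) * (D $$ (i, j) * s $ j))"
      by (simp add: sum_distrib_right mult.assoc)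
    also have "\<dots> = (\<Sum>i<m. D $$ (i, k) * l i)"
      unfolding l_def sum_distrib_left by (rule sum.swap)
    \<comment> \<open>The factor \<open>D $$ (i, k)\<close> selects the \<open>c k\<close> machines
      holding \<open>k\<close>, each with load at most \<open>?M\<close>.\<close>
    also have "\<dots> \<le> (\<Sum>i<m. D $$ (i, k) * ?M)"
      using lM D0 k(1) by (intro sum_mono mult_left_mono) auto
    also have "\<dots> = c k * ?M"
      by (simp add: c_def sum_distrib_right)
    also have "\<dots> \<le> real n * ?M"
      using ck M0 by (rule mult_right_mono)
    \<comment> \<open>Scaling by \<open>n + 1\<close> creates the factor \<open>n * (n + 1)\<close>,
      which is at most \<open>m\<close> by hypothesis.\<close>
    finally have "(real n + 1) * 1 \<le> (real n + 1) * (real n * ?M)"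
      by (intro mult_left_mono) auto
    also have "\<dots> = real (n * (n + 1)) * ?M"
      by (simp add: algebra_simps)
    also have "\<dots> \<le> real m * ?M"
      using m M0 by (intro mult_right_mono of_nat_mono)
    finally show ?thesis
      by simp
  qed
  then show ?thesis
    using m0 by (simp add: divide_le_eq mult.commute)
qed

text \<open>Carries a row sum of the incidence matrix over to the plane, whatever enumeration of the
  points is chosen.\<close>

lemma sum_indicator_eq_card_via_bij:
  assumes "bij_betw f B A" "finite B"
  shows "(\<Sum>j\<in>B. if Q (f j) then 1 else 0 :: real) = real (card {a \<in> A. Q a})"
proof -
  have "finite A"
    using bij_betw_finite[OF assms(1)] assms(2) by simp
  then have "real (card {a \<in> A. Q a}) = (\<Sum>a\<in>A. if Q a then 1 else 0)"
    by (simp add: sum.If_cases Collect_conj_eq)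
  then show ?thesis
    using sum.reindex_bij_betw[OF assms(1), of "\<lambda>a. if Q a then 1 else 0 :: real"] by simp
qed

text \<open>Any two points share a line, which gives ATAC; every line has \<open>n + 1\<close>
  points of weight \<open>1 / m\<close>, so all loads agree.\<close>

lemma projective_plane_ATAC_storage_limit:
  assumes plane: "projective_plane n P L inc" and inc: "is_incidence_matrix P L inc D"
    and m: "m = n^2 + n + 1" and s_def: "s = vec m (\<lambda>_. 1 / real m)"
  shows "ATAC_distribution m D s" and "storage_limit D s = (real n + 1) / real m"
proof -
  have card: "card P = m" "card L = m"
    using plane m by (auto simp: projective_plane_def)
  obtain line point where line: "bij_betw line {..<m} L" and point: "bij_betw point {..<m} P"
    and D_def: "D = mat m m (\<lambda>(i, j). if inc (point j) (line i) then 1 else 0)"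
    using inc card by (auto simp: is_incidence_matrix_def)
  have m0: "m > 0"
    using m by simp
  have D: "D \<in> carrier_mat m m" and s: "s \<in> carrier_vec m"
    by (auto simp: D_def s_def)
  have pt: "point j \<in> P" if "j < m" for j
    using point that by (auto simp: bij_betw_def)
  have ln: "line i \<in> L" if "i < m" for i
    using line that by (auto simp: bij_betw_def)
  have Dd: "D $$ (i, j) = (if inc (point j) (line i) then 1 else 0)" if "i < m" "j < m" for i j
    using that by (simp add: D_def)
  have common: "\<exists>i<m. inc (point j) (line i) \<and> inc (point k) (line i)"
    if "j < m" "k < m" for j k
  proof -
    have "\<exists>l\<in>L. inc (point j) l \<and> inc (point k) l"
    \<comment> \<open>The axiom on joining lines covers only distinct points; for equal ones, any of
      the \<open>n + 1\<close> lines through the point will do.\<close>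
    proof (cases "point j = point k")
      case True
      have "card {l \<in> L. inc (point j) l} = n + 1"
        using plane pt that by (auto simp: projective_plane_def)
      then have "{l \<in> L. inc (point j) l} \<noteq> {}"
        by (metis Suc_eq_plus1 card.empty nat.distinct(1))
      with True show ?thesis by auto
    next
      case False
      with plane pt[OF that(1)] pt[OF that(2)] show ?thesis
        unfolding projective_plane_def by blast
    qed
    then show ?thesis
      using bij_betw_imp_surj_on[OF line] by (metis imageE lessThan_iff)
  qed
  have gram: "(transpose_mat D * D) $$ (j, k) \<noteq> 0" if jk: "j < m" "k < m" for j k
  proof -
    obtain i where i: "i < m" "inc (point j) (line i)" "inc (point k) (line i)"
      using common[OF jk] by blast
    \<comment> \<open>No summand is negative, and the one of the common line is 1.\<close>
    have "(\<Sum>i<m. D $$ (i, j) * D $$ (i, k)) > 0"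
      using i jk by (intro sum_pos2[of _ i]) (auto simp: Dd)
    then show ?thesis
      using gram_entry_eq_sum[OF D jk] by simp
  qed
  have "data_distribution m D s"
    unfolding data_distribution_def using m0 D s
    by (intro exI[of _ m]) (auto simp: Dd s_def)
  then show "ATAC_distribution m D s"
    unfolding ATAC_distribution_def using gram D by auto
  have "(D *\<^sub>v s) $ i = (real n + 1) / real m" if i: "i < m" for i
  proof -
    have "(D *\<^sub>v s) $ i = (\<Sum>j<m. D $$ (i, j)) / real m"
      using load_eq_sum[OF D s i] by (simp add: s_def sum_divide_distrib)
    also have "(\<Sum>j<m. D $$ (i, j)) = (\<Sum>j<m. if inc (point j) (line i) then 1 else 0)"
      using i by (intro sum.cong) (auto simp: Dd)
    also have "\<dots> = real (card {p \<in> P. inc p (line i)})"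
      by (rule sum_indicator_eq_card_via_bij[OF point]) simp
    also have "\<dots> = real n + 1"
      using plane ln[OF i] by (simp add: projective_plane_def)
    finally show ?thesis .
  qed
  then show "storage_limit D s = (real n + 1) / real m"
    using D m0 by (intro storage_limit_constant) auto
qed

theorem theorem8:
  fixes n m :: nat
    and P :: "'p set" and L :: "'l set" and inc :: "'p \<Rightarrow> 'l \<Rightarrow> bool"
    and D :: "real mat" and s :: "real vec"
  assumes "n \<ge> 1"
    and "projective_plane n P L inc"
    and "is_incidence_matrix P L inc D"
    and "m = n^2 + n + 1"
    and "s = vec m (\<lambda>_. 1 / real m)"
  shows "ATAC_distribution m D s \<and> storage_limit D s = min_storage_limit m"
proof
  note plane = projective_plane_ATAC_storage_limit[OF assms(2-5)]
  show ATAC: "ATAC_distribution m D s"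
    by (rule plane)
  \<comment> \<open>Here \<open>m\<close> is \<open>n * (n + 1) + 1\<close>, so the lower bound
    applies to every competitor.\<close>
  have "n * (n + 1) \<le> m"
    using assms(4) by (simp add: power2_eq_square)
  then have "storage_limit D s \<le> storage_limit D' s'" if "ATAC_distribution m D' s'" for D' s'
    using ATAC_storage_limit_ge[OF that] plane(2) by simp
  \<comment> \<open>The lower bound is attained by \<open>D\<close> and \<open>s\<close>, so the
    \<open>LEAST\<close> over the reals exists and equals it.\<close>
  with ATAC have "min_storage_limit m = storage_limit D s"
    unfolding min_storage_limit_def by (intro Least_equality) auto
  then show "storage_limit D s = min_storage_limit m"
    by simp
qed

end
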